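(* Let $\dot\Upsilon=f(\Upsilon,u,t)$, with $\Upsilon=[\zeta_1~\eta_1~\zeta_2~\eta_2]\in\mathbb{R}^{Nd_\zeta+Md_\eta}$, $f=[\phi_1~\psi_1~\phi_2~\psi_2]$ and control $u=[\phi_2~\psi_2]$, be the control system of a dynamic parameterized sequential decision making problem, and let $\mathcal{V}(\Upsilon)=\sum_{s\in\mathcal{S}}V^*_{\beta\Upsilon}(s)$ (all as defined in the context). Let $F$ be the vector of partial derivatives of $\mathcal{V}$ with respect to $\zeta_2,\eta_2$, let $G$ be the vector of partial derivatives of $\mathcal{V}$ with respect to $\zeta_1,\eta_1$, let $\kappa^T=[\phi_1^T~\psi_1^T]$ and $\alpha=G^T\kappa$. Let $K_0>0$ and consider the control $$u(F)=-\left[K_0+\frac{\alpha+\sqrt{\alpha^2+(F^TF)^2}}{F^TF}\right]F\quad\text{if }F\ne0,\qquad u(F)=0\quad\text{if }F=0.$$ Suppose there exists a control $\hat u:\mathbb{R}^{Nd_\zeta+Md_\eta}\to\mathbb{R}^{|\mathcal{S}_2|d_\zeta+|\mathcal{A}_2|d_\eta}$ that is Lipschitz at $F=0$ and such that, for this control, $\dot{\mathcal{V}}=G^T\kappa+F^T\hat u\le0$ (at every $\Upsilon$) for all $t\ge0$. Then the control $u(F)$ is Lipschitz at $F=0$; that is, there exist $\epsilon>0$ and a constant $c_0$ such that $\|u(F)\|\le c_0\|F\|$ whenever $\|F\|\le\epsilon$.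
   Context: **Parameterized problem.** $\mathcal{S}=\{s_1,\dots,s_N=\delta\}$ is a finite state space with cost-free termination state $\delta$; $\mathcal{A}=\{a_1,\dots,a_M\}$ is a finite action space; $c:\mathcal{S}\times\mathcal{A}\times\mathcal{S}\to\mathbb{R}$ is the transition cost, whose value $c(s,a,s')$ depends on the parameters $\zeta_s,\eta_a,\zeta_{s'}$; $p(s'|s,a)\in[0,1]$ is the state transition probability (not depending on the parameters); $0<\gamma\le1$ is a discount factor; $\zeta=\{\zeta_s\in\mathbb{R}^{d_\zeta}:s\in\mathcal{S}\}$ and $\eta=\{\eta_a\in\mathbb{R}^{d_\eta}:a\in\mathcal{A}\}$ are the state and action parameters. It is assumed that there is at least one proper policy $\bar\mu(a|s)\in\{0,1\}$, for all parameter values, i.e. a policy under which there is a non-zero probability to reach $\delta$ starting from any state. **Value functions.** A policy $\mu(\cdot|s)$ induces a distribution $p_\mu(\omega|s)$ on infinite paths $\omega=(u_0,x_1,u_1,x_2,\dots)$ with $x_0=s$, $u_k\in\mathcal{A}$, $x_k\in\mathcal{S}$, namely $p_\mu(\omega|x_0)=\prod_{k\ge0}\mu(u_k|x_k)p(x_{k+1}|x_k,u_k)$. The cumulative cost is $J^\mu_\Upsilon(s)=\mathbb{E}_{p_\mu}[\sum_{k\ge0}\gamma^kc(x_k,u_k,x_{k+1})\,|\,x_0=s]$, and the path entropy is $\mathcal{H}^\mu(s)=-\sum_\omega p_\mu(\omega|s)\log p_\mu(\omega|s)$. Policies range over $\Gamma=\{\pi:0<\rho\le\pi(a|s)<1\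 \forall a\in\mathcal{A},s\in\mathcal{S}\}$, the set of proper control policies, with $\rho>0$ arbitrarily small; $\mathcal{H}^\mu(s)$ is finite for $\mu\in\Gamma$. Fix $\beta>0$. The Lagrangian is $V^\mu_{\beta\Upsilon}(s)=J^\mu_\Upsilon(s)-\frac1\beta\mathcal{H}^\mu(s)$ (up to an additive term $c_0(s)$ depending on $\gamma,\beta$ but not on $\mu$ or $\Upsilon$, which is ignored, and which is unrelated to the constant $c_0$ in the claim). The free energy $V^*_{\beta\Upsilon}(s)=\min_{\mu\in\Gamma}V^\mu_{\beta\Upsilon}(s)$ is the value function at the optimal policy $$\mu^*_{\beta\Upsilon}(a|s)=\frac{\exp\{-(\beta/\gamma)\Lambda_{\beta\Upsilon}(s,a)\}}{\sum_{a'\in\mathcal{A}}\exp\{-(\beta/\gamma)\Lambda_{\beta\Upsilon}(s,a')\}},$$ and is given by $$V^*_{\beta\Upsilon}(s)=-\frac{\gamma}{\beta}\log\Big(\sum_{a\in\mathcal{A}}\exp\{-\tfrac{\beta}{\gamma}\Lambda_{\beta\Upsilon}(s,a)\}\Big),$$ where $\Lambda_{\beta\Upsilon}$ is the fixed point of the map (known to be a contraction) $$[T\Lambda](s,a)=\sum_{s'}p(s'|s,a)\big(c(s,a,s')+\tfrac{\gamma}{\beta}\log p(s'|s,a)\big)-\frac{\gamma^2}{\beta}\sum_{s'}p(s'|s,a)\log\sum_{a'}\exp\{-\tfrac{\beta}{\gamma}\Lambda(s',a')\}$$ (convention $0\log0=0$). $V^*_{\beta\Upsilon}(s)$ is regarded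 as a smooth function of $\Upsilon$. **Dynamics.** $\mathcal{S}=\mathcal{S}_1\sqcup\mathcal{S}_2$ and $\mathcal{A}=\mathcal{A}_1\sqcup\mathcal{A}_2$. The parameters $\zeta_1=\{\zeta_s\}_{s\in\mathcal{S}_1}$, $\eta_1=\{\eta_a\}_{a\in\mathcal{A}_1}$ have pre-specified dynamics $\dot\zeta_1=\phi_1(\zeta,\eta,t)$, $\dot\eta_1=\psi_1(\zeta,\eta,t)$ with $\phi_1,\psi_1\in C^1$. The parameters $\zeta_2=\{\zeta_s\}_{s\in\mathcal{S}_2}$, $\eta_2=\{\eta_a\}_{a\in\mathcal{A}_2}$ have manipulable dynamics $\dot\zeta_2=\phi_2$, $\dot\eta_2=\psi_2$, where $u=[\phi_2~\psi_2]$ is the control. **Derivative notation.** $G=\big[(\partial\mathcal{V}/\partial\zeta_s)_{s\in\mathcal{S}_1},(\partial\mathcal{V}/\partial\eta_a)_{a\in\mathcal{A}_1}\big]\in\mathbb{R}^{|\mathcal{S}_1|d_\zeta+|\mathcal{A}_1|d_\eta}$ and $F=\big[(\partial\mathcal{V}/\partial\zeta_s)_{s\in\mathcal{S}_2},(\partial\mathcal{V}/\partial\eta_a)_{a\in\mathcal{A}_2}\big]\in\mathbb{R}^{|\mathcal{S}_2|d_\zeta+|\mathcal{A}_2|d_\eta}$, so that along the control system $\dot{\mathcal{V}}=G^T\kappa+F^Tu$; $F$, $G$, $\kappa$, $\alpha$ are evaluated at the current $(\Upsilon,t)$. A control $v$ is called Lipschitz at $F=0$ if there exist $r>0$ and $k$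 such that $\|v\|\le k\|F\|$ whenever $\|F\|\le r$. $\|\cdot\|$ is the Euclidean norm.
   Formalization: For γ = 1 the displayed fixed-point equation has no solution at the absorbing cost-free state δ when there are at least two actions; there the equation is imposed only at states s ≠ δ, together with V*(δ) = 0. For γ < 1 it is used as displayed. *)

theory Defs
  imports "HOL-Probability.Probability"
begin

section \<open>Smoothness and gradients\<close>

definition partial_deriv :: "('b::euclidean_space \<Rightarrow> real) \<Rightarrow> 'b \<Rightarrow> 'b \<Rightarrow> real" where
  "partial_deriv f b x = deriv (\<lambda>h. f (x + h *\<^sub>R b)) 0"

definition gradient :: "('b::euclidean_space \<Rightarrow> real) \<Rightarrow> 'b \<Rightarrow> 'b" where
  "gradient f x = (\<Sum>b\<in>Basis. partial_deriv f b x *\<^sub>R b)"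

primrec continuously_differentiable :: "nat \<Rightarrow> ('b::euclidean_space \<Rightarrow> real) \<Rightarrow> bool" where
  "continuously_differentiable 0 f \<longleftrightarrow> continuous_on UNIV f"
| "continuously_differentiable (Suc k) f \<longleftrightarrow>
     (\<forall>x. f differentiable (at x)) \<and>
     (\<forall>b\<in>Basis. continuously_differentiable k (partial_deriv f b))"

definition smooth :: "('b::euclidean_space \<Rightarrow> real) \<Rightarrow> bool" where
  "smooth f \<longleftrightarrow> (\<forall>k. continuously_differentiable k f)"

definition C1_on :: "'b::real_normed_vector set \<Rightarrow> ('b \<Rightarrow> 'c::real_normed_vector) \<Rightarrow> bool" where
  "C1_on X f \<longleftrightarrow>
     (\<exists>D :: 'b \<Rightarrow> 'b \<Rightarrow>\<^sub>L 'c.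
        (\<forall>x\<in>X. (f has_derivative blinfun_apply (D x)) (at x within X)) \<and> continuous_on X D)"


section \<open>Proper policies\<close>

text \<open>The state after n steps from s, with actions drawn from the policy \<open>\<mu>\<close>.\<close>

primrec state_after ::
    "('s \<Rightarrow> 'a \<Rightarrow> 's pmf) \<Rightarrow> ('s \<Rightarrow> 'a pmf) \<Rightarrow> nat \<Rightarrow> 's \<Rightarrow> 's pmf" where
  "state_after p \<mu> 0 s = return_pmf s"
| "state_after p \<mu> (Suc n) s = bind_pmf (bind_pmf (\<mu> s) (p s)) (state_after p \<mu> n)"

definition deterministic_policy :: "('s \<Rightarrow> 'a pmf) \<Rightarrow> bool" where
  "deterministic_policy \<mu> \<longleftrightarrow> (\<forall>s a. pmf (\<mu> s) a \<in> {0, 1})"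

definition proper_policy ::
    "('s \<Rightarrow> 'a \<Rightarrow> 's pmf) \<Rightarrow> 's \<Rightarrow> ('s \<Rightarrow> 'a pmf) \<Rightarrow> bool" where
  "proper_policy p \<delta> \<mu> \<longleftrightarrow> (\<forall>s. \<exists>n. pmf (state_after p \<mu> n s) \<delta> > 0)"


section \<open>Parameterized costs and the free energy\<close>

text \<open>A parameter vector is a pair \<open>(\<zeta>, \<eta>)\<close> of a state part and an action part; its norm
  and inner product are the Euclidean ones on all scalar coordinates.\<close>

type_synonym ('s, 'a, 'z, 'e) params = "((real, 'z) vec, 's) vec \<times> ((real, 'e) vec, 'a) vec"

definition transition_cost ::
    "('s \<Rightarrow> 'a \<Rightarrow> 's \<Rightarrow> real^'z \<Rightarrow> real^'e \<Rightarrow> real^'z \<Rightarrow> real)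
      \<Rightarrow> ('s::finite, 'a::finite, 'z::finite, 'e::finite) params \<Rightarrow> 's \<Rightarrow> 'a \<Rightarrow> 's \<Rightarrow> real" where
  "transition_cost c \<Upsilon> s a s' = c s a s' (fst \<Upsilon> $ s) (snd \<Upsilon> $ a) (fst \<Upsilon> $ s')"

text \<open>The convention \<open>0 log 0 = 0\<close> is respected because of the factor in front of the logarithm.\<close>

definition soft_bellman ::
    "('s::finite \<Rightarrow> 'a::finite \<Rightarrow> 's pmf) \<Rightarrow> real \<Rightarrow> real \<Rightarrow> ('s \<Rightarrow> 'a \<Rightarrow> 's \<Rightarrow> real)
      \<Rightarrow> ('s \<Rightarrow> 'a \<Rightarrow> real) \<Rightarrow> 's \<Rightarrow> 'a \<Rightarrow> real" where
  "soft_bellman p \<gamma> \<beta> C \<Lambda> s a =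
     (\<Sum>s'\<in>UNIV. pmf (p s a) s' * (C s a s' + \<gamma> / \<beta> * ln (pmf (p s a) s')))
     - \<gamma>\<^sup>2 / \<beta> * (\<Sum>s'\<in>UNIV. pmf (p s a) s' * ln (\<Sum>a'\<in>UNIV. exp (- (\<beta> / \<gamma>) * \<Lambda> s' a')))"

definition free_energy ::
    "real \<Rightarrow> real \<Rightarrow> ('s \<Rightarrow> 'a::finite \<Rightarrow> real) \<Rightarrow> 's \<Rightarrow> real" where
  "free_energy \<gamma> \<beta> \<Lambda> s = - (\<gamma> / \<beta>) * ln (\<Sum>a\<in>UNIV. exp (- (\<beta> / \<gamma>) * \<Lambda> s a))"

text \<open>For \<open>\<gamma> < 1\<close> this is the fixed-point equation. For \<open>\<gamma> = 1\<close> the equation at the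
  absorbing cost-free state \<open>\<delta>\<close> reads \<open>\<Lambda> \<delta> a = free_energy 1 \<beta> \<Lambda> \<delta>\<close>, hence
  \<open>x = x - ln CARD('a) / \<beta>\<close>, which has no solution for two or more actions. In that case the
  process ends in \<open>\<delta>\<close> with free energy 0, and the equation is imposed elsewhere.\<close>

definition soft_bellman_fixed_point ::
    "('s::finite \<Rightarrow> 'a::finite \<Rightarrow> 's pmf) \<Rightarrow> 's \<Rightarrow> real \<Rightarrow> real \<Rightarrow> ('s \<Rightarrow> 'a \<Rightarrow> 's \<Rightarrow> real)
      \<Rightarrow> ('s \<Rightarrow> 'a \<Rightarrow> real) \<Rightarrow> bool" where
  "soft_bellman_fixed_point p \<delta> \<gamma> \<beta> C \<Lambda> \<longleftrightarrow>
     (if \<gamma> < 1 then soft_bellman p \<gamma> \<beta> C \<Lambda> = \<Lambda>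
      else (\<forall>s a. s \<noteq> \<delta> \<longrightarrow> soft_bellman p \<gamma> \<beta> C \<Lambda> s a = \<Lambda> s a) \<and> free_energy \<gamma> \<beta> \<Lambda> \<delta> = 0)"


section \<open>The control law\<close>

text \<open>Vectors indexed by the parameters of the states in \<open>S\<close> and the actions in \<open>A\<close> only are
  represented as full parameter vectors vanishing at all other states and actions.\<close>

definition subparams ::
    "'s set \<Rightarrow> 'a set \<Rightarrow> ('s::finite, 'a::finite, 'z::finite, 'e::finite) params set" where
  "subparams S A = {v. (\<forall>s. s \<notin> S \<longrightarrow> fst v $ s = 0) \<and> (\<forall>a. a \<notin> A \<longrightarrow> snd v $ a = 0)}"

definition restrict_params ::
    "'s set \<Rightarrow> 'a set \<Rightarrow> ('s::finite, 'a::finite, 'z::finite, 'e::finite) params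
      \<Rightarrow> ('s, 'a, 'z, 'e) params" where
  "restrict_params S A v =
     (\<chi> s. if s \<in> S then fst v $ s else 0, \<chi> a. if a \<in> A then snd v $ a else 0)"

definition control_law :: "real \<Rightarrow> real \<Rightarrow> 'b::real_inner \<Rightarrow> 'b" where
  "control_law K\<^sub>0 \<alpha> F =
     (if F = 0 then 0
      else - ((K\<^sub>0 + (\<alpha> + sqrt (\<alpha>\<^sup>2 + (F \<bullet> F)\<^sup>2)) / (F \<bullet> F)) *\<^sub>R F))"

definition lipschitz_at_zero ::
    "('b \<Rightarrow> 'c::real_normed_vector) \<Rightarrow> ('b \<Rightarrow> real \<Rightarrow> 'd::real_normed_vector) \<Rightarrow> bool" where
  "lipschitz_at_zero F v \<longleftrightarrow>
     (\<exists>r>0. \<exists>k. \<forall>\<Upsilon>. \<forall>t\<ge>0. norm (F \<Upsilon>) \<le> r \<longrightarrow> norm (v \<Upsilon> t) \<le> k * norm (F \<Upsilon>))"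

end

theory Submission
  imports Defs
begin

text \<open>
  The control points along \<open>F\<close>, so its Lipschitz constant is the size of the scalar gain
  \<open>K\<^sub>0 + (\<alpha> + sqrt (\<alpha>\<^sup>2 + q\<^sup>2)) / q\<close>, where \<open>q = F \<bullet> F\<close>. As \<open>q\<close> tends to 0 the gain can
  only blow up through positive \<open>\<alpha>\<close> of larger order than \<open>q\<close>: since \<open>sqrt (\<alpha>\<^sup>2 + q\<^sup>2) \<le> \<bar>\<alpha>\<bar> + q\<close>, negative values of \<open>\<alpha>\<close>
  cancel and leave at most \<open>q\<close>, however large they are. It is therefore enough to bound \<open>\<alpha>\<close> from
  above by a multiple of \<open>q\<close>, uniformly in the parameters and in time, and this is what the
  comparison control \<open>v\<close> provides. It does not let the value increase, so the drift satisfies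
  \<open>\<alpha> \<le> - (F \<bullet> v)\<close>, and \<open>norm v \<le> k * norm F\<close> turns this into \<open>\<alpha> \<le> k * q\<close> by the
  Cauchy-Schwarz inequality.
\<close>

text \<open>A one-sided bound on \<open>\<alpha>\<close> suffices because the square root is at most \<open>\<bar>\<alpha>\<bar> + q\<close>, and the sum
  \<open>\<alpha> + \<bar>\<alpha>\<bar>\<close> vanishes for \<open>\<alpha> \<le> 0\<close> and is at most \<open>2 * k * q\<close> otherwise.\<close>

lemma sontag_numerator_le:
  fixes \<alpha> q k :: real
  assumes "0 \<le> q" "0 \<le> k" "\<alpha> \<le> k * q"
  shows "\<alpha> + sqrt (\<alpha>\<^sup>2 + q\<^sup>2) \<le> (2 * k + 1) * q"
proof -
  have "sqrt (\<alpha>\<^sup>2 + q\<^sup>2) \<le> \<bar>\<alpha>\<bar> + q"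
    using sqrt_sum_squares_le_sum_abs[of \<alpha> q] assms(1) by simp
  moreover have "\<alpha> + \<bar>\<alpha>\<bar> \<le> 2 * (k * q)"
    using assms by (simp add: abs_if)
  ultimately show ?thesis
    by (simp add: algebra_simps)
qed

lemma norm_control_law_le:
  fixes F :: "'b::real_inner"
  assumes "0 \<le> K\<^sub>0" "0 \<le> k" "\<alpha> \<le> k * (F \<bullet> F)"
  shows "norm (control_law K\<^sub>0 \<alpha> F) \<le> (K\<^sub>0 + 2 * k + 1) * norm F"
proof (cases "F = 0")
  case True
  then show ?thesis
    by (simp add: control_law_def)
next
  case False
  then have q: "0 < F \<bullet> F"
    by simp
  define g where "g = K\<^sub>0 + (\<alpha> + sqrt (\<alpha>\<^sup>2 + (F \<bullet> F)\<^sup>2)) / (F \<bullet> F)"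
  have "- \<alpha> \<le> sqrt (\<alpha>\<^sup>2 + (F \<bullet> F)\<^sup>2)"
    by (rule real_le_rsqrt) simp
  then have "0 \<le> (\<alpha> + sqrt (\<alpha>\<^sup>2 + (F \<bullet> F)\<^sup>2)) / (F \<bullet> F)"
    using q by simp
  moreover have "(\<alpha> + sqrt (\<alpha>\<^sup>2 + (F \<bullet> F)\<^sup>2)) / (F \<bullet> F) \<le> 2 * k + 1"
    using sontag_numerator_le[of "F \<bullet> F" k \<alpha>] assms q by (simp add: pos_divide_le_eq)
  ultimately have "\<bar>g\<bar> \<le> K\<^sub>0 + 2 * k + 1"
    using assms(1) unfolding g_def by linarith
  moreover have "norm (control_law K\<^sub>0 \<alpha> F) = \<bar>g\<bar> * norm F"
    using False by (simp add: control_law_def g_def)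
  ultimately show ?thesis
    by (simp add: mult_right_mono)
qed

text \<open>The quantity \<open>\<alpha> + F \<bullet> v\<close> is the rate of change of the value under the control \<open>v\<close>. When
  \<open>norm v\<close> is at most \<open>k * norm F\<close>, the control can offset a drift \<open>\<alpha>\<close> of size at most \<open>k * (F \<bullet> F)\<close>.\<close>

lemma drift_le_of_decay:
  fixes F v :: "'b::real_inner"
  assumes decay: "\<alpha> + F \<bullet> v \<le> 0" and bound: "norm v \<le> k * norm F"
  shows "\<alpha> \<le> k * (F \<bullet> F)"
proof -
  have "\<alpha> \<le> \<bar>F \<bullet> v\<bar>"
    using decay by linarith
  also have "\<dots> \<le> norm F * norm v"
    by (rule Cauchy_Schwarz_ineq2)
  also have "\<dots> \<le> norm F * (k * norm F)"
    using bound by (simp add: mult_left_mono)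
  also have "\<dots> = k * (F \<bullet> F)"
    by (simp add: dot_square_norm power2_eq_square)
  finally show ?thesis .
qed

theorem theorem3:
  fixes p :: "'s::finite \<Rightarrow> 'a::finite \<Rightarrow> 's pmf"
    and \<delta> :: 's
    and c :: "'s \<Rightarrow> 'a \<Rightarrow> 's \<Rightarrow> real^'z \<Rightarrow> real^'e \<Rightarrow> real^'z \<Rightarrow> real"
    and \<gamma> \<beta> K\<^sub>0 :: real
    and S\<^sub>1 S\<^sub>2 :: "'s set"
    and A\<^sub>1 A\<^sub>2 :: "'a set"
    and \<Lambda> :: "('s, 'a, 'z::finite, 'e::finite) params \<Rightarrow> 's \<Rightarrow> 'a \<Rightarrow> real"
    and V :: "('s, 'a, 'z, 'e) params \<Rightarrow> real"
    and \<phi>\<^sub>1 :: "('s, 'a, 'z, 'e) params \<Rightarrow> real \<Rightarrow> real^'z^'s"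
    and \<psi>\<^sub>1 :: "('s, 'a, 'z, 'e) params \<Rightarrow> real \<Rightarrow> real^'e^'a"
    and \<kappa> :: "('s, 'a, 'z, 'e) params \<Rightarrow> real \<Rightarrow> ('s, 'a, 'z, 'e) params"
    and F G :: "('s, 'a, 'z, 'e) params \<Rightarrow> ('s, 'a, 'z, 'e) params"
    and \<alpha> :: "('s, 'a, 'z, 'e) params \<Rightarrow> real \<Rightarrow> real"
    and u :: "('s, 'a, 'z, 'e) params \<Rightarrow> real \<Rightarrow> ('s, 'a, 'z, 'e) params"
    and u_hat :: "('s, 'a, 'z, 'e) params \<Rightarrow> ('s, 'a, 'z, 'e) params"
  assumes absorbing: "\<And>a. p \<delta> a = return_pmf \<delta>"
    and cost_free: "\<And>a z e z'. c \<delta> a \<delta> z e z' = 0"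
    and discount: "0 < \<gamma>" "\<gamma> \<le> 1"
    and beta: "0 < \<beta>"
    and proper: "\<exists>\<mu>. deterministic_policy \<mu> \<and> proper_policy p \<delta> \<mu>"
    and Lambda: "\<And>\<Upsilon>. soft_bellman_fixed_point p \<delta> \<gamma> \<beta> (transition_cost c \<Upsilon>) (\<Lambda> \<Upsilon>)"
    and smooth: "\<And>s. smooth (\<lambda>\<Upsilon>. free_energy \<gamma> \<beta> (\<Lambda> \<Upsilon>) s)"
    and V: "\<And>\<Upsilon>. V \<Upsilon> = (\<Sum>s\<in>UNIV. free_energy \<gamma> \<beta> (\<Lambda> \<Upsilon>) s)"
    and states: "S\<^sub>1 \<union> S\<^sub>2 = UNIV" "S\<^sub>1 \<inter> S\<^sub>2 = {}"
    and actions: "A\<^sub>1 \<union> A\<^sub>2 = UNIV" "A\<^sub>1 \<inter> A\<^sub>2 = {}"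
    and phi_C1: "C1_on (UNIV \<times> {0..}) (\<lambda>(\<Upsilon>, t). \<phi>\<^sub>1 \<Upsilon> t)"
    and psi_C1: "C1_on (UNIV \<times> {0..}) (\<lambda>(\<Upsilon>, t). \<psi>\<^sub>1 \<Upsilon> t)"
    and kappa: "\<And>\<Upsilon> t. \<kappa> \<Upsilon> t = (\<phi>\<^sub>1 \<Upsilon> t, \<psi>\<^sub>1 \<Upsilon> t)"
    and kappa_range: "\<And>\<Upsilon> t. 0 \<le> t \<Longrightarrow> \<kappa> \<Upsilon> t \<in> subparams S\<^sub>1 A\<^sub>1"
    and G: "\<And>\<Upsilon>. G \<Upsilon> = restrict_params S\<^sub>1 A\<^sub>1 (gradient V \<Upsilon>)"
    and F: "\<And>\<Upsilon>. F \<Upsilon> = restrict_params S\<^sub>2 A\<^sub>2 (gradient V \<Upsilon>)"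
    and alpha: "\<And>\<Upsilon> t. \<alpha> \<Upsilon> t = G \<Upsilon> \<bullet> \<kappa> \<Upsilon> t"
    and K0: "0 < K\<^sub>0"
    and u: "\<And>\<Upsilon> t. u \<Upsilon> t = control_law K\<^sub>0 (\<alpha> \<Upsilon> t) (F \<Upsilon>)"
    and u_hat_range: "\<And>\<Upsilon>. u_hat \<Upsilon> \<in> subparams S\<^sub>2 A\<^sub>2"
    and u_hat_lipschitz: "lipschitz_at_zero F (\<lambda>\<Upsilon> t. u_hat \<Upsilon>)"
    and u_hat_decay: "\<And>\<Upsilon> t. 0 \<le> t \<Longrightarrow> G \<Upsilon> \<bullet> \<kappa> \<Upsilon> t + F \<Upsilon> \<bullet> u_hat \<Upsilon> \<le> 0"
  shows "\<exists>\<epsilon>>0. \<exists>c\<^sub>0. \<forall>\<Upsilon>. \<forall>t\<ge>0. norm (F \<Upsilon>) \<le> \<epsilon> \<longrightarrow> norm (u \<Upsilon> t) \<le> c\<^sub>0 * norm (F \<Upsilon>)"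
proof -
  obtain r k where r: "0 < r"
    and k: "\<And>\<Upsilon>. norm (F \<Upsilon>) \<le> r \<Longrightarrow> norm (u_hat \<Upsilon>) \<le> k * norm (F \<Upsilon>)"
    using u_hat_lipschitz unfolding lipschitz_at_zero_def by fastforce
  have "norm (u \<Upsilon> t) \<le> (K\<^sub>0 + 2 * \<bar>k\<bar> + 1) * norm (F \<Upsilon>)"
    if t: "0 \<le> t" and small: "norm (F \<Upsilon>) \<le> r" for \<Upsilon> t
  proof -
    \<comment> \<open>The Lipschitz condition does not fix the sign of \<open>k\<close>: it may be negative if \<open>F\<close> does not
      take small nonzero values. The gain bound calls for a nonnegative constant.\<close>
    have "norm (u_hat \<Upsilon>) \<le> \<bar>k\<bar> * norm (F \<Upsilon>)"
      using k[OF small] by (meson abs_ge_self mult_right_mono norm_ge_zero order_trans)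
    with u_hat_decay[OF t, of \<Upsilon>] have "\<alpha> \<Upsilon> t \<le> \<bar>k\<bar> * (F \<Upsilon> \<bullet> F \<Upsilon>)"
      unfolding alpha by (rule drift_le_of_decay)
    then show ?thesis
      unfolding u using K0 by (intro norm_control_law_le) auto
  qed
  with r show ?thesis
    by blast
qed

end
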